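(* Let $\xi=(\xi_t)_{0\le t\le T}$ be a progressively measurable target process with $\xi_0\in L^2(\mathbb P)$ and $\mathbb E\int_0^T\xi_t^2\,dt<\infty$, let $x\in\mathbb R$ be the initial position, let $v(\kappa)$ be the value of the unconstrained quadratic tracking problem and $\omega_\xi$ the squared $L^2$ time-translation modulus of $\xi$. Then for every $\kappa>0$, $$v(\kappa)\le \sqrt{\kappa}\,\mathbb E[(x-\xi_0)^2]+\frac{2}{\sqrt{\kappa}}\int_0^\infty e^{-h/\sqrt{\kappa}}\,\omega_\xi(h)\,dh .$$
   Context: Fix $T>0$, a filtered probability space $(\Omega,\mathcal F,(\mathcal F_t)_{0\le t\le T},\mathbb P)$ satisfying the usual conditions, and $x\in\mathbb R$. Let $\mathcal U$ be the set of progressively measurable processes $u=(u_t)_{0\le t\le T}$ with $\mathbb E\int_0^T u_t^2\,dt<\infty$, and for $u\in\mathcal U$ let $X^u_t=x+\int_0^t u_s\,ds$, $0\le t\le T$. For $\kappa\ge 0$ set $$J_\kappa(u)=\mathbb E\Big[\tfrac12\int_0^T(X^u_t-\xi_t)^2\,dt+\tfrac{\kappa}{2}\int_0^Tu_t^2\,dt\Big],\qquad v(\kappa)=\inf_{u\in\mathcal U}J_\kappa(u).$$ The modulus is $\omega_\xi(h)=\mathbb E\int_0^T|\xi_t-\xi_{(t-h)^+}|^2\,dt$ for $h>0$, where $(t-h)^+=\max\{t-h,0\}$. *)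

theory Defs
  imports "HOL-Probability.Probability"
begin

text \<open>
  The library locale \<^locale>\<open>filtration\<close> is indexed by a whole type; here the index set is
  the interval \<open>{0..T}\<close>, and the values of \<open>F\<close> outside it are irrelevant.
  Only the spaces and sigma-algebras of the measures \<open>F t\<close> matter.
\<close>

locale usual_filtered_prob_space = prob_space M + complete_measure M
  for M :: "'a measure" and F :: "real \<Rightarrow> 'a measure" and T :: real +
  assumes horizon_pos: "0 < T"
    and subalg: "\<And>t. t \<in> {0..T} \<Longrightarrow> subalgebra M (F t)"
    and mono: "\<And>s t. 0 \<le> s \<Longrightarrow> s \<le> t \<Longrightarrow> t \<le> T \<Longrightarrow> sets (F s) \<subseteq> sets (F t)"
    and right_continuous: "\<And>t. 0 \<le> t \<Longrightarrow> t < T \<Longrightarrow> sets (F t) = (\<Inter>s\<in>{t<..T}. sets (F s))"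
    and null_sets_initial: "null_sets M \<subseteq> sets (F 0)"

definition progressively_measurable ::
  "(real \<Rightarrow> 'a measure) \<Rightarrow> real \<Rightarrow> (real \<Rightarrow> 'a \<Rightarrow> real) \<Rightarrow> bool" where
  "progressively_measurable F T u \<longleftrightarrow>
     (\<forall>t\<in>{0..T}. (\<lambda>(s, \<omega>). u s \<omega>) \<in> borel_measurable (restrict_space borel {0..t} \<Otimes>\<^sub>M F t))"

text \<open>
  Expectations and integrals of nonnegative quantities are taken in the extended nonnegative
  reals, so that finiteness is never hidden in a convention for non-integrable functions.
\<close>

definition expected_energy :: "'a measure \<Rightarrow> real \<Rightarrow> (real \<Rightarrow> 'a \<Rightarrow> real) \<Rightarrow> ennreal" where
  "expected_energy M T u = (\<integral>\<^sup>+\<omega>. (\<integral>\<^sup>+t\<in>{0..T}. ennreal ((u t \<omega>)\<^sup>2) \<partial>lborel) \<partial>M)"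

definition admissible_controls ::
  "'a measure \<Rightarrow> (real \<Rightarrow> 'a measure) \<Rightarrow> real \<Rightarrow> (real \<Rightarrow> 'a \<Rightarrow> real) set" where
  "admissible_controls M F T =
     {u. progressively_measurable F T u \<and> expected_energy M T u < \<infinity>}"

text \<open>
  For an admissible \<open>u\<close> the path \<open>u(\<cdot>, \<omega>)\<close> is integrable on \<open>{0..T}\<close> for almost every \<open>\<omega>\<close>;
  on the exceptional null set the Bochner integral takes an arbitrary value, which does not affect
  the cost.
\<close>

definition controlled_state :: "real \<Rightarrow> (real \<Rightarrow> 'a \<Rightarrow> real) \<Rightarrow> real \<Rightarrow> 'a \<Rightarrow> real" where
  "controlled_state x u t \<omega> = x + (LINT s:{0..t}|lborel. u s \<omega>)"

definition tracking_cost ::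
  "'a measure \<Rightarrow> real \<Rightarrow> real \<Rightarrow> (real \<Rightarrow> 'a \<Rightarrow> real) \<Rightarrow> real \<Rightarrow> (real \<Rightarrow> 'a \<Rightarrow> real) \<Rightarrow> ennreal" where
  "tracking_cost M T x \<xi> \<kappa> u =
     (\<integral>\<^sup>+\<omega>. (ennreal (1 / 2) * (\<integral>\<^sup>+t\<in>{0..T}. ennreal ((controlled_state x u t \<omega> - \<xi> t \<omega>)\<^sup>2) \<partial>lborel)
           + ennreal (\<kappa> / 2) * (\<integral>\<^sup>+t\<in>{0..T}. ennreal ((u t \<omega>)\<^sup>2) \<partial>lborel)) \<partial>M)"

definition tracking_value ::
  "'a measure \<Rightarrow> (real \<Rightarrow> 'a measure) \<Rightarrow> real \<Rightarrow> real \<Rightarrow> (real \<Rightarrow> 'a \<Rightarrow> real) \<Rightarrow> real \<Rightarrow> ennreal" where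
  "tracking_value M F T x \<xi> \<kappa> = (INF u\<in>admissible_controls M F T. tracking_cost M T x \<xi> \<kappa> u)"

definition translation_modulus ::
  "'a measure \<Rightarrow> real \<Rightarrow> (real \<Rightarrow> 'a \<Rightarrow> real) \<Rightarrow> real \<Rightarrow> ennreal" where
  "translation_modulus M T \<xi> h =
     (\<integral>\<^sup>+\<omega>. (\<integral>\<^sup>+t\<in>{0..T}. ennreal (\<bar>\<xi> t \<omega> - \<xi> (max (t - h) 0) \<omega>\<bar>\<^sup>2) \<partial>lborel) \<partial>M)"

end

theory Submission
  imports Defs
begin

text \<open>
  With \<open>l = sqrt \<kappa>\<close>, let the state \<open>X\<close> be the exponential moving average of the target, that is
  \<open>l X' = \<xi> - X\<close>, \<open>X 0 = x\<close>. The control \<open>u = X'\<close> then satisfies \<open>\<kappa> u\<^sup>2 = (\<xi> - X)\<^sup>2\<close>, so that its cost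
  is the expectation of \<open>\<integral>(X - \<xi>)\<^sup>2\<close>. The error \<open>X t - \<xi> t\<close> is \<open>e\<^bsup>-t/l\<^esup> (x - \<xi> 0)\<close> plus the mean of
  \<open>\<xi> (max (t - h) 0) - \<xi> t\<close> over an exponential variable \<open>h\<close> of mean \<open>l\<close>; the bound follows from
  \<open>(a + b)\<^sup>2 \<le> 2 a\<^sup>2 + 2 b\<^sup>2\<close>, Jensen's inequality and Tonelli's theorem.
\<close>

section \<open>The exponential moving average and its differential equation\<close>

definition exp_average :: "real \<Rightarrow> real \<Rightarrow> (real \<Rightarrow> real) \<Rightarrow> real \<Rightarrow> real" where
  "exp_average l x f t =
     exp (- t / l) * x + (LINT s:{0..t}|lborel. exp (- (t - s) / l) / l * f s)"

lemma exp_average_cong: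
  assumes "\<And>s. 0 \<le> s \<Longrightarrow> s \<le> t \<Longrightarrow> f s = g s"
  shows "exp_average l x f t = exp_average l x g t"
  using assms unfolding exp_average_def by (auto intro!: set_lebesgue_integral_cong)

text \<open>The shift \<open>c\<close> serves two uses: \<open>c = r\<close> when the value at time
  \<open>r\<close> is propagated forward, and \<open>c = 0\<close> for the decay of the initial
  position and for the exponential law.\<close>

lemma has_bochner_integral_exp_kernel:
  fixes a b c l :: real
  assumes "0 < l" "a \<le> b"
  shows "has_bochner_integral lborel (\<lambda>s. indicator {a..b} s * (exp (- (s - c) / l) / l))
           (exp (- (a - c) / l) - exp (- (b - c) / l))"
proof -
  have "has_bochner_integral lborel (\<lambda>s. (exp (- (s - c) / l) / l) * indicator {a..b} s)
      ((- exp (- (b - c) / l)) - (- exp (- (a - c) / l)))"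
  proof (rule has_bochner_integral_FTC_Icc_nonneg)
    show "((\<lambda>s. - exp (- (s - c) / l)) has_real_derivative exp (- (s - c) / l) / l) (at s)" for s
      using assms by (auto intro!: derivative_eq_intros simp: field_simps)
  qed (use assms in auto)
  then show ?thesis by (simp add: mult.commute)
qed

text \<open>Integrated form of l X' = f - X. Since \<open>f\<close> is merely integrable, nothing is
  differentiated; instead the double integral of the exponential kernel is computed in both
  orders.\<close>

lemma exp_average_eq_primitive:
  assumes l: "0 < l" and t: "0 \<le> t" and f: "set_integrable lborel {0..t} f"
  shows "exp_average l x f t = x + (LINT s:{0..t}|lborel. (f s - exp_average l x f s) / l)"
proof -
  define g where "g r = indicator {0..t} r * f r" for r
  have g: "integrable lborel g"
    using f by (simp add: set_integrable_def g_def[abs_def])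
  have [measurable]: "g \<in> borel_measurable borel"
    using borel_measurable_integrable[OF g] by simp
  \<comment> \<open>\<open>K\<close> lives on the triangle 0 <= r <= s <= t. Integrating over
    \<open>r\<close> gives the memory term of the average at time \<open>s\<close>; integrating over
    \<open>s\<close> gives an explicit expression.\<close>
  define K where "K s r = indicator {0..t} s * (indicator {r..} s * (exp (- (s - r) / l) / l)) * g r"
    for s r
  have K_meas: "(\<lambda>(s, r). K s r) \<in> borel_measurable (lborel \<Otimes>\<^sub>M lborel)"
    unfolding K_def by (simp add: split_beta' indicator_def of_bool_def)
  \<comment> \<open>The exponential is at most 1 where r <= s, so \<open>K\<close> is dominated by
    an integrable product; this supplies the hypotheses of Fubini's theorem.\<close>
  have K_le: "norm (K s r) \<le> indicator {0..t} s * (\<bar>g r\<bar> / l)" for s r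
    using l by (auto simp: K_def indicator_def abs_mult field_simps mult_left_le)
  have K_int: "integrable (lborel \<Otimes>\<^sub>M lborel) (\<lambda>(s, r). K s r)"
  proof (rule lborel_pair.Fubini_integrable[OF K_meas])
    have le: "(LINT r|lborel. norm (K s r)) \<le> indicator {0..t} s * (LINT r|lborel. \<bar>g r\<bar> / l)" for s
    proof -
      have "(LINT r|lborel. norm (K s r)) \<le> (LINT r|lborel. indicator {0..t} s * (\<bar>g r\<bar> / l))"
        by (rule integral_mono') (use K_le g l in auto)
      then show ?thesis by simp
    qed
    have "integrable lborel (\<lambda>s. indicator {0..t} s * (LINT r|lborel. \<bar>g r\<bar> / l))"
      using t by (intro integrable_mult_left) auto
    then show "integrable lborel (\<lambda>s. LINT r|lborel. norm (case (s, r) of (s, r) \<Rightarrow> K s r))"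
    proof (rule Bochner_Integration.integrable_bound)
      show "(\<lambda>s. LINT r|lborel. norm (case (s, r) of (s, r) \<Rightarrow> K s r)) \<in> borel_measurable lborel"
        using K_meas by (intro lborel.borel_measurable_lebesgue_integral) (auto simp: split_beta')
      show "AE s in lborel. norm (LINT r|lborel. norm (case (s, r) of (s, r) \<Rightarrow> K s r))
          \<le> norm (indicator {0..t} s * (LINT r|lborel. \<bar>g r\<bar> / l))"
        using le l by (simp add: abs_of_pos)
    qed
    show "AE s in lborel. integrable lborel (\<lambda>r. case (s, r) of (s, r) \<Rightarrow> K s r)"
    proof (intro AE_I2)
      fix s :: real
      show "integrable lborel (\<lambda>r. case (s, r) of (s, r) \<Rightarrow> K s r)"
      proof (rule Bochner_Integration.integrable_bound)
        show "integrable lborel (\<lambda>r. \<bar>g r\<bar> / l)" using g by auto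
        show "(\<lambda>r. case (s, r) of (s, r) \<Rightarrow> K s r) \<in> borel_measurable lborel"
          unfolding K_def by (simp add: indicator_def of_bool_def)
        have "norm (K s r) \<le> norm (\<bar>g r\<bar> / l)" for r
          using K_le[of s r] l by (cases "s \<in> {0..t}") auto
        then show "AE r in lborel. norm (case (s, r) of (s, r) \<Rightarrow> K s r) \<le> norm (\<bar>g r\<bar> / l)"
          by simp
      qed
    qed
  qed
  \<comment> \<open>The kernel started at \<open>r\<close> has mass
    \<open>1 - exp (- (t - r) / l)\<close> up to time \<open>t\<close>. For \<open>r\<close> outside
    \<open>{0..t}\<close> both sides vanish with \<open>g r\<close>.\<close>
  have K_fst: "(LINT s|lborel. K s r) = g r - g r * exp (- (t - r) / l)" for r
  proof (cases "r \<in> {0..t}")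
    case True
    have "(LINT s|lborel. K s r)
        = (LINT s|lborel. (indicator {r..t} s * (exp (- (s - r) / l) / l)) * g r)"
      using True by (intro Bochner_Integration.integral_cong) (auto simp: K_def indicator_def)
    also have "\<dots> = (exp (- (r - r) / l) - exp (- (t - r) / l)) * g r"
      using has_bochner_integral_mult_left[OF has_bochner_integral_exp_kernel[OF l, of r t r]] True
      by (auto simp: has_bochner_integral_iff)
    finally show ?thesis by (simp add: algebra_simps)
  qed (simp add: K_def g_def)
  have K_snd: "(LINT r|lborel. K s r)
      = indicator {0..t} s * (exp_average l x f s - exp (- s / l) * x)" for s
    unfolding exp_average_def set_lebesgue_integral_def
    by (auto simp: K_def g_def indicator_def intro!: Bochner_Integration.integral_cong)
  have "integrable lborel (\<lambda>s. LINT r|lborel. K s r)"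
    using lborel_pair.integrable_fst'[OF K_int] by simp
  then have K_snd_int: "has_bochner_integral lborel (\<lambda>s. LINT r|lborel. K s r)
      (LINT s|lborel. LINT r|lborel. K s r)"
    by (simp add: has_bochner_integral_iff)
  \<comment> \<open>\<open>c / l\<close> is the memory term of the average at the final time
    \<open>t\<close>.\<close>
  define c where "c = (LINT r|lborel. g r * exp (- (t - r) / l))"
  have gexp: "integrable lborel (\<lambda>r. g r * exp (- (t - r) / l))"
  proof (rule Bochner_Integration.integrable_bound[OF g])
    have "norm (g r * exp (- (t - r) / l)) \<le> norm (g r)" for r
      using l by (auto simp: g_def indicator_def abs_mult intro!: mult_left_le divide_nonpos_pos)
    then show "AE r in lborel. norm (g r * exp (- (t - r) / l)) \<le> norm (g r)"
      by simp
  qed simp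
  have "(LINT s|lborel. LINT r|lborel. K s r) = (LINT r|lborel. LINT s|lborel. K s r)"
    by (rule lborel_pair.Fubini_integral[OF K_int, symmetric])
  also have "\<dots> = (LINT r|lborel. g r) - c"
    using g gexp by (simp add: K_fst c_def)
  finally have dbl: "(LINT s|lborel. LINT r|lborel. K s r) = (LINT r|lborel. g r) - c" .
  \<comment> \<open>On \<open>{0..t}\<close> this integrand is
    \<open>(f s - exp_average l x f s) / l\<close>: the last term supplies the decaying initial
    position, which \<open>K\<close> lacks. The two integrals of \<open>g\<close> cancel and leave
    \<open>c / l - (1 - exp (- t / l)) * x\<close>.\<close>
  have "has_bochner_integral lborel
     (\<lambda>s. (g s - (LINT r|lborel. K s r)) / l - indicator {0..t} s * (exp (- (s - 0) / l) / l) * x)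
     (((LINT r|lborel. g r) - ((LINT r|lborel. g r) - c)) / l - (exp (- (0 - 0) / l) - exp (- (t - 0) / l)) * x)"
    using K_snd_int t unfolding dbl
    by (intro has_bochner_integral_diff has_bochner_integral_mult_left has_bochner_integral_divide_zero
        has_bochner_integral_exp_kernel[OF l] has_bochner_integral_integrable[OF g]) auto
  then have "(LINT s|lborel. (g s - (LINT r|lborel. K s r)) / l - indicator {0..t} s * (exp (- (s - 0) / l) / l) * x)
      = c / l - x + exp (- t / l) * x"
    unfolding has_bochner_integral_iff by (simp add: left_diff_distrib)
  moreover have "(LINT s:{0..t}|lborel. (f s - exp_average l x f s) / l)
    = (LINT s|lborel. (g s - (LINT r|lborel. K s r)) / l - indicator {0..t} s * (exp (- (s - 0) / l) / l) * x)"
    unfolding set_lebesgue_integral_def K_snd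
    using l by (intro Bochner_Integration.integral_cong) (auto simp: g_def indicator_def field_simps)
  moreover have "exp_average l x f t = exp (- t / l) * x + c / l"
    unfolding exp_average_def set_lebesgue_integral_def c_def
    by (auto simp: g_def intro!: Bochner_Integration.integral_cong
        simp flip: Bochner_Integration.integral_divide_zero)
  ultimately show ?thesis by simp
qed

section \<open>Jensen's inequality and the pathwise tracking error\<close>

lemma (in prob_space) ennreal_power2_expectation_le:
  assumes [measurable]: "f \<in> borel_measurable M"
  shows "ennreal ((expectation f)\<^sup>2) \<le> (\<integral>\<^sup>+x. ennreal ((f x)\<^sup>2) \<partial>M)"
proof (cases "integrable M (\<lambda>x. (f x)\<^sup>2)")
  case True
  have f: "integrable M f"
    using True by (rule square_integrable_imp_integrable[OF assms])
  \<comment> \<open>Jensen's inequality for the square is nonnegativity of the variance.\<close>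
  have "(expectation f)\<^sup>2 \<le> expectation (\<lambda>x. (f x)\<^sup>2)"
    using variance_positive[of f] unfolding variance_eq[OF f True] by simp
  moreover have "(\<integral>\<^sup>+x. ennreal ((f x)\<^sup>2) \<partial>M) = ennreal (expectation (\<lambda>x. (f x)\<^sup>2))"
    using True by (rule nn_integral_eq_integral) simp
  ultimately show ?thesis
    by (simp only: ennreal_leI)
next
  case False
  \<comment> \<open>Without square integrability the right-hand side is infinite, so the bound holds
    even where \<open>expectation f\<close> is the default 0.\<close>
  then have "(\<integral>\<^sup>+x. ennreal ((f x)\<^sup>2) \<partial>M) = \<infinity>"
    by (simp add: integrable_iff_bounded less_top[symmetric])
  then show ?thesis by (simp only: infinity_ennreal_def top_greatest)
qed

text \<open>Let \<open>h\<close> be exponential with mean \<open>l\<close>. On h <= t the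
  substitution s = t - h produces the memory integral; the event h > t has probability
  \<open>exp (- t / l)\<close>, and there the clamp returns \<open>f 0\<close>. Hence the mean of
  \<open>f (max (t - h) 0)\<close> is the average started at \<open>f 0\<close>, and starting at
  \<open>x\<close> instead adds \<open>exp (- t / l) * (x - f 0)\<close>.\<close>

lemma exp_average_diff_eq:
  assumes l: "0 < l" and t: "0 \<le> t" and f: "set_integrable lborel {0..t} f"
    and [measurable]: "f \<in> borel_measurable borel"
  shows "exp_average l x f t - f t = exp (- t / l) * (x - f 0)
     + (LINT h|density lborel (exponential_density (1 / l)). f (max (t - h) 0) - f t)"
proof -
  interpret P: prob_space "density lborel (exponential_density (1 / l))"
    using l by (intro prob_space_exponential_density) simp
  define p where "p h = exponential_density (1 / l) h" for h
  have p_eq: "p h = (if h < 0 then 0 else exp (- h / l) / l)" for h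
    by (simp add: p_def exponential_density_def)
  have [measurable]: "p \<in> borel_measurable borel"
    unfolding p_def[abs_def] by simp
  have p_nonneg: "0 \<le> p h" for h
    using l by (simp add: p_eq)
  have "integrable (density lborel p) (\<lambda>_. 1::real)"
    unfolding p_def by simp
  then have "integrable lborel p"
    by (subst (asm) integrable_real_density) (auto simp: p_nonneg)
  moreover have "(LINT h|density lborel p. 1::real) = 1"
    unfolding p_def using P.prob_space by simp
  then have "integral\<^sup>L lborel p = 1"
    by (subst (asm) integral_real_density) (auto simp: p_nonneg)
  ultimately have p: "has_bochner_integral lborel p 1"
    by (simp add: has_bochner_integral_iff)
  define k where "k s = indicator {0..t} s * (exp (- (t - s) / l) / l * f s)" for s
  have f': "integrable lborel (\<lambda>s. indicator {0..t} s * f s)"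
    using f by (simp add: set_integrable_def)
  have "integrable lborel k"
  proof (rule Bochner_Integration.integrable_bound)
    show "integrable lborel (\<lambda>s. indicator {0..t} s * f s / l)"
      using f' by simp
    have [measurable]: "(\<lambda>s. indicator {0..t} s * f s) \<in> borel_measurable borel"
      using borel_measurable_integrable[OF f'] by simp
    have "(\<lambda>s. exp (- (t - s) / l) / l * (indicator {0..t} s * f s)) \<in> borel_measurable lborel"
      by measurable
    then show "k \<in> borel_measurable lborel"
      by (simp add: k_def[abs_def] mult_ac)
    have "norm (k s) \<le> norm (indicator {0..t} s * f s / l)" for s
    proof (cases "s \<in> {0..t}")
      case True
      then have "exp (- (t - s) / l) \<le> 1"
        using l by (simp add: divide_nonpos_pos)
      then have "exp (- (t - s) / l) * \<bar>f s\<bar> \<le> \<bar>f s\<bar>"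
        by (intro mult_left_le_one_le) auto
      then show ?thesis
        using True l by (simp add: k_def abs_mult divide_right_mono)
    qed (simp add: k_def)
    then show "AE s in lborel. norm (k s) \<le> norm (indicator {0..t} s * f s / l)"
      by simp
  qed
  then have "has_bochner_integral lborel k (LINT s:{0..t}|lborel. exp (- (t - s) / l) / l * f s)"
    by (simp add: has_bochner_integral_iff set_lebesgue_integral_def k_def[abs_def])
  \<comment> \<open>Reflection s = t - h, whose Jacobian factor is 1.\<close>
  then have k: "has_bochner_integral lborel (\<lambda>h. k (t + (- 1) * h))
      (LINT s:{0..t}|lborel. exp (- (t - s) / l) / l * f s)"
    using lborel_has_bochner_integral_real_affine_iff
        [of "- 1" k "LINT s:{0..t}|lborel. exp (- (t - s) / l) / l * f s" t] by simp
  \<comment> \<open>The bracket is the density restricted to h > t, with mass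
    \<open>exp (- t / l)\<close>, and carries \<open>f 0\<close>; the last term uses the total mass
    1.\<close>
  have "has_bochner_integral lborel
      (\<lambda>h. k (t + (- 1) * h) + (p h - indicator {0..t} h * (exp (- (h - 0) / l) / l)) * f 0 - p h * f t)
      ((LINT s:{0..t}|lborel. exp (- (t - s) / l) / l * f s)
        + (1 - (exp (- (0 - 0) / l) - exp (- (t - 0) / l))) * f 0 - 1 * f t)"
    by (intro has_bochner_integral_diff has_bochner_integral_add has_bochner_integral_mult_left
        k p has_bochner_integral_exp_kernel l t)
  moreover have "k (t + (- 1) * h) + (p h - indicator {0..t} h * (exp (- (h - 0) / l) / l)) * f 0 - p h * f t
      = p h *\<^sub>R (f (max (t - h) 0) - f t)" for h
  proof -
    consider "h < 0" | "0 \<le> h" "h \<le> t" | "0 \<le> h" "t < h" by linarith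
    then show ?thesis
      by cases (simp_all add: p_eq k_def max_def right_diff_distrib)
  qed
  moreover have "(LINT s:{0..t}|lborel. exp (- (t - s) / l) / l * f s)
        + (1 - (exp (- (0 - 0) / l) - exp (- (t - 0) / l))) * f 0 - 1 * f t
      = exp_average l x f t - f t - exp (- t / l) * (x - f 0)"
    by (simp add: exp_average_def right_diff_distrib)
  ultimately have "has_bochner_integral lborel (\<lambda>h. p h *\<^sub>R (f (max (t - h) 0) - f t))
      (exp_average l x f t - f t - exp (- t / l) * (x - f 0))"
    by (simp only:)
  then have "(LINT h|density lborel p. f (max (t - h) 0) - f t)
      = exp_average l x f t - f t - exp (- t / l) * (x - f 0)"
    by (subst integral_density) (simp_all add: has_bochner_integral_iff p_nonneg)
  then show ?thesis by (simp add: p_def[abs_def])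
qed

lemma exp_average_error_le:
  assumes l: "0 < l" and t: "0 \<le> t" and f: "set_integrable lborel {0..t} f"
    and [measurable]: "f \<in> borel_measurable borel"
  shows "ennreal ((exp_average l x f t - f t)\<^sup>2)
    \<le> ennreal (2 * exp (- 2 * t / l) * (x - f 0)\<^sup>2)
      + ennreal (2 / l) * (\<integral>\<^sup>+h\<in>{0<..}.
          (ennreal (exp (- h / l)) * ennreal (\<bar>f t - f (max (t - h) 0)\<bar>\<^sup>2)) \<partial>lborel)"
proof -
  let ?P = "density lborel (exponential_density (1 / l))"
  interpret P: prob_space ?P
    using l by (intro prob_space_exponential_density) simp
  define b where "b = (LINT h|?P. f (max (t - h) 0) - f t)"
  have "ennreal (b\<^sup>2) \<le> (\<integral>\<^sup>+h. ennreal ((f (max (t - h) 0) - f t)\<^sup>2) \<partial>?P)"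
    unfolding b_def by (rule P.ennreal_power2_expectation_le) simp
  also have "\<dots> = (\<integral>\<^sup>+h. ennreal (exponential_density (1 / l) h) * ennreal ((f (max (t - h) 0) - f t)\<^sup>2) \<partial>lborel)"
    by (rule nn_integral_density) auto
  also have "\<dots> = (\<integral>\<^sup>+h. ennreal (1 / l) * (ennreal (exp (- h / l)) * ennreal (\<bar>f t - f (max (t - h) 0)\<bar>\<^sup>2) * indicator {0<..} h) \<partial>lborel)"
  proof (rule nn_integral_cong_AE)
    \<comment> \<open>The density is supported on h >= 0 while the target integral runs over
      \<open>{0<..}\<close>; the point 0 is a null set.\<close>
    have "AE h in lborel. h \<noteq> (0::real)" by (rule AE_lborel_singleton)
    then show "AE h in lborel. ennreal (exponential_density (1 / l) h) * ennreal ((f (max (t - h) 0) - f t)\<^sup>2)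
        = ennreal (1 / l) * (ennreal (exp (- h / l)) * ennreal (\<bar>f t - f (max (t - h) 0)\<bar>\<^sup>2) * indicator {0<..} h)"
    proof eventually_elim
      case (elim h)
      have sq: "(f (max (t - h) 0) - f t)\<^sup>2 = \<bar>f t - f (max (t - h) 0)\<bar>\<^sup>2"
        by (simp add: power2_commute)
      show ?case
      proof (cases "0 < h")
        case True
        then have density: "exponential_density (1 / l) h = 1 / l * exp (- h / l)"
          by (simp add: exponential_density_def)
        have "ennreal (exponential_density (1 / l) h) = ennreal (1 / l) * ennreal (exp (- h / l))"
          unfolding density using l by (intro ennreal_mult) auto
        with True show ?thesis
          unfolding sq by (simp only: mult.assoc indicator_simps greaterThan_iff mult_1_right)
      next
        case False
        with elim show ?thesis by (simp add: exponential_density_def)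
      qed
    qed
  qed
  also have "\<dots> = ennreal (1 / l) * (\<integral>\<^sup>+h\<in>{0<..}. (ennreal (exp (- h / l)) * ennreal (\<bar>f t - f (max (t - h) 0)\<bar>\<^sup>2)) \<partial>lborel)"
    by (rule nn_integral_cmult) simp
  finally have b: "ennreal (b\<^sup>2) \<le> \<dots>" .
  have "(exp_average l x f t - f t)\<^sup>2 \<le> 2 * (exp (- t / l) * (x - f 0))\<^sup>2 + 2 * b\<^sup>2"
    unfolding exp_average_diff_eq[OF l t f assms(4)] b_def[symmetric]
    using sum_squares_bound[of "exp (- t / l) * (x - f 0)" b] by (simp add: power2_sum)
  also have "2 * (exp (- t / l) * (x - f 0))\<^sup>2 = 2 * exp (- 2 * t / l) * (x - f 0)\<^sup>2"
    by (simp add: power_mult_distrib flip: exp_of_nat_mult)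
  finally have "ennreal ((exp_average l x f t - f t)\<^sup>2)
      \<le> ennreal (2 * exp (- 2 * t / l) * (x - f 0)\<^sup>2) + 2 * ennreal (b\<^sup>2)"
    by (subst ennreal_numeral[symmetric], subst ennreal_mult[symmetric])
      (auto intro!: ennreal_leI simp flip: ennreal_plus)
  also have "\<dots> \<le> ennreal (2 * exp (- 2 * t / l) * (x - f 0)\<^sup>2)
      + 2 * (ennreal (1 / l) * (\<integral>\<^sup>+h\<in>{0<..}. (ennreal (exp (- h / l)) * ennreal (\<bar>f t - f (max (t - h) 0)\<bar>\<^sup>2)) \<partial>lborel))"
    using b by (intro add_mono mult_left_mono) auto
  \<comment> \<open>The factor \<open>2 / l\<close> joins the 2 from squaring a sum with the
    \<open>1 / l\<close> of the exponential density.\<close>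
  also have "2 * (ennreal (1 / l) * c) = ennreal (2 / l) * c" for c
    using l by (simp add: ennreal_mult[of 2 "1 / l", simplified] mult.assoc)
  finally show ?thesis .
qed

text \<open>Holds by |y| <= 1 + y^2 on an interval of finite length. It turns finite path energy
  into the integrability required by the averages.\<close>

lemma set_integrable_if_square_nn_integral_finite:
  fixes f :: "real \<Rightarrow> real"
  assumes [measurable]: "f \<in> borel_measurable borel"
    and fin: "(\<integral>\<^sup>+t\<in>{a..b}. ennreal ((f t)\<^sup>2) \<partial>lborel) < \<infinity>"
  shows "set_integrable lborel {a..b} f"
proof -
  have "(\<integral>\<^sup>+t. ennreal (norm (indicator {a..b} t * (f t)\<^sup>2)) \<partial>lborel)
      = (\<integral>\<^sup>+t\<in>{a..b}. ennreal ((f t)\<^sup>2) \<partial>lborel)"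
    by (intro nn_integral_cong) (auto simp: indicator_def)
  with fin have "integrable lborel (\<lambda>t. indicator {a..b} t * (f t)\<^sup>2)"
    by (simp add: integrable_iff_bounded)
  moreover have "integrable lborel (\<lambda>t. indicator {a..b} t :: real)"
    by (rule integrable_real_indicator) (auto simp: emeasure_lborel_Icc_eq)
  ultimately have "integrable lborel (\<lambda>t. indicator {a..b} t + indicator {a..b} t * (f t)\<^sup>2)"
    by (rule Bochner_Integration.integrable_add[rotated])
  then have "integrable lborel (\<lambda>t. indicator {a..b} t * f t)"
  proof (rule Bochner_Integration.integrable_bound)
    have "\<bar>y\<bar> \<le> 1 + y\<^sup>2" for y :: real
      using sum_squares_bound[of "\<bar>y\<bar>" 1] by simp
    then show "AE t in lborel. norm (indicator {a..b} t * f t)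
        \<le> norm (indicator {a..b} t + indicator {a..b} t * (f t)\<^sup>2)"
      by (auto simp: indicator_def)
  qed simp
  then show ?thesis by (simp add: set_integrable_def)
qed

lemma nn_integral_exp_le:
  assumes l: "0 < l" and c: "0 \<le> c"
  shows "(\<integral>\<^sup>+t\<in>{0..T}. ennreal (2 * exp (- 2 * t / l) * c) \<partial>lborel) \<le> ennreal (l * c)"
proof (cases "0 \<le> T")
  case True
  have "(\<integral>\<^sup>+t\<in>{0..T}. ennreal (2 * exp (- 2 * t / l) * c) \<partial>lborel)
      = ennreal (- l * c * exp (- 2 * T / l) - (- l * c * exp (- 2 * 0 / l)))"
    by (rule nn_integral_FTC_Icc)
      (use l c True in \<open>auto intro!: derivative_eq_intros simp: field_simps\<close>)
  also have "\<dots> \<le> ennreal (l * c)"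
    using l c by (intro ennreal_leI) auto
  finally show ?thesis .
qed simp

text \<open>The pointwise error bound is integrated in \<open>t\<close>, and Tonelli moves the
  \<open>h\<close> integral outside, so that the inner integral is the translation modulus of a
  single path.\<close>

lemma nn_integral_exp_average_error_le:
  assumes l: "0 < l" and f: "set_integrable lborel {0..T} f"
    and [measurable]: "f \<in> borel_measurable borel"
  shows "(\<integral>\<^sup>+t\<in>{0..T}. ennreal ((exp_average l x f t - f t)\<^sup>2) \<partial>lborel)
    \<le> ennreal (l * (x - f 0)\<^sup>2) + ennreal (2 / l) * (\<integral>\<^sup>+h\<in>{0<..}. (ennreal (exp (- h / l))
          * (\<integral>\<^sup>+t\<in>{0..T}. ennreal (\<bar>f t - f (max (t - h) 0)\<bar>\<^sup>2) \<partial>lborel)) \<partial>lborel)"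
proof -
  define D where "D t h = ennreal (exp (- h / l)) * ennreal (\<bar>f t - f (max (t - h) 0)\<bar>\<^sup>2)
      * indicator {0<..} h" for t h
  have D[measurable]: "case_prod D \<in> borel_measurable (borel \<Otimes>\<^sub>M borel)"
    unfolding D_def by measurable
  have "(\<integral>\<^sup>+t\<in>{0..T}. ennreal ((exp_average l x f t - f t)\<^sup>2) \<partial>lborel)
    \<le> (\<integral>\<^sup>+t. ennreal (2 * exp (- 2 * t / l) * (x - f 0)\<^sup>2) * indicator {0..T} t
        + ennreal (2 / l) * ((\<integral>\<^sup>+h. D t h \<partial>lborel) * indicator {0..T} t) \<partial>lborel)"
  proof (rule nn_integral_mono)
    fix t
    show "ennreal ((exp_average l x f t - f t)\<^sup>2) * indicator {0..T} t
      \<le> ennreal (2 * exp (- 2 * t / l) * (x - f 0)\<^sup>2) * indicator {0..T} t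
        + ennreal (2 / l) * ((\<integral>\<^sup>+h. D t h \<partial>lborel) * indicator {0..T} t)"
    proof (cases "t \<in> {0..T}")
      case True
      then show ?thesis
        using exp_average_error_le[OF l, of t f x] set_integrable_subset[OF f, of "{0..t}"]
        by (simp add: D_def)
    qed simp
  qed
  also have "\<dots> = (\<integral>\<^sup>+t\<in>{0..T}. ennreal (2 * exp (- 2 * t / l) * (x - f 0)\<^sup>2) \<partial>lborel)
      + ennreal (2 / l) * (\<integral>\<^sup>+t. (\<integral>\<^sup>+h. D t h \<partial>lborel) * indicator {0..T} t \<partial>lborel)"
    by (simp add: nn_integral_add nn_integral_cmult)
  also have "(\<integral>\<^sup>+t. (\<integral>\<^sup>+h. D t h \<partial>lborel) * indicator {0..T} t \<partial>lborel)
      = (\<integral>\<^sup>+t. (\<integral>\<^sup>+h. D t h * indicator {0..T} t \<partial>lborel) \<partial>lborel)"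
    by (simp add: nn_integral_multc)
  also have "\<dots> = (\<integral>\<^sup>+h. (\<integral>\<^sup>+t. D t h * indicator {0..T} t \<partial>lborel) \<partial>lborel)"
    by (rule lborel_pair.Fubini'[symmetric]) simp
  also have "\<dots> = (\<integral>\<^sup>+h\<in>{0<..}. (ennreal (exp (- h / l))
          * (\<integral>\<^sup>+t\<in>{0..T}. ennreal (\<bar>f t - f (max (t - h) 0)\<bar>\<^sup>2) \<partial>lborel)) \<partial>lborel)"
    by (intro nn_integral_cong)
      (auto simp: D_def mult_ac simp flip: nn_integral_cmult)
  finally show ?thesis
    by (rule order_trans) (use nn_integral_exp_le[OF l, of "(x - f 0)\<^sup>2" T] in \<open>auto intro: add_right_mono\<close>)
qed

section \<open>Measurability of progressive processes and their averages\<close>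

lemma progressively_measurable_clamp:
  assumes u: "progressively_measurable F T u" and t: "t \<in> {0..T}"
  shows "(\<lambda>(s, \<omega>). u (max 0 (min s t)) \<omega>) \<in> borel_measurable (borel \<Otimes>\<^sub>M F t)"
proof -
  \<comment> \<open>The clamp sends the whole line into \<open>{0..t}\<close> and is the identity
    there, so composing with it extends \<open>u\<close> from \<open>{0..t}\<close> to a Borel time
    axis.\<close>
  have "(\<lambda>s. max 0 (min s t)) \<in> borel \<rightarrow>\<^sub>M restrict_space borel {0..t}"
    using t by (intro measurable_restrict_space2) auto
  then have "(\<lambda>(s, \<omega>). (max 0 (min s t), \<omega>)) \<in> borel \<Otimes>\<^sub>M F t \<rightarrow>\<^sub>M restrict_space borel {0..t} \<Otimes>\<^sub>M F t"
    by simp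
  moreover have "(\<lambda>(s, \<omega>). u s \<omega>) \<in> borel_measurable (restrict_space borel {0..t} \<Otimes>\<^sub>M F t)"
    using u t by (simp add: progressively_measurable_def)
  ultimately have "(\<lambda>p. case (case p of (s, \<omega>) \<Rightarrow> (max 0 (min s t), \<omega>)) of (s, \<omega>) \<Rightarrow> u s \<omega>)
      \<in> borel_measurable (borel \<Otimes>\<^sub>M F t)"
    by (rule measurable_compose)
  then show ?thesis by (simp add: split_beta')
qed

text \<open>At times s <= t the average reads \<open>u\<close> on \<open>{0..s}\<close> only, so
  \<open>u\<close> may be frozen at \<open>t\<close>. Freezing there keeps the integrand measurable
  for \<open>F t\<close>, and a parametrized integral of a jointly measurable function is
  measurable.\<close>

lemma progressively_measurable_exp_average:
  assumes u: "progressively_measurable F T u"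
  shows "progressively_measurable F T (\<lambda>t \<omega>. exp_average l x (\<lambda>s. u s \<omega>) t)"
  unfolding progressively_measurable_def
proof
  fix t assume t: "t \<in> {0..T}"
  let ?N = "restrict_space borel {0..t} \<Otimes>\<^sub>M F t"
  note [measurable] = progressively_measurable_clamp[OF u t]
  have s[measurable]: "fst \<in> borel_measurable ?N"
    using measurable_compose[OF measurable_fst measurable_restrict_space1[OF measurable_ident]]
    by (simp add: id_def)
  have "(\<lambda>p. exp (- fst p / l) * x + (LINT r|lborel. indicator {0..fst p} r *
      (exp (- (fst p - r) / l) / l * (case (r, snd p) of (r, \<omega>) \<Rightarrow> u (max 0 (min r t)) \<omega>))))
    \<in> borel_measurable ?N"
    unfolding indicator_def of_bool_def by (simp del: prod.case)
  moreover have "exp (- fst p / l) * x + (LINT r|lborel. indicator {0..fst p} r *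
      (exp (- (fst p - r) / l) / l * (case (r, snd p) of (r, \<omega>) \<Rightarrow> u (max 0 (min r t)) \<omega>)))
      = (case p of (s, \<omega>) \<Rightarrow> exp_average l x (\<lambda>s. u s \<omega>) s)" if "p \<in> space ?N" for p
    using that unfolding exp_average_def set_lebesgue_integral_def
    by (auto simp: space_pair_measure space_restrict_space indicator_def max_def min_def
        intro!: Bochner_Integration.integral_cong)
  ultimately show "(\<lambda>(s, \<omega>). exp_average l x (\<lambda>s. u s \<omega>) s) \<in> borel_measurable ?N"
    by (subst (asm) measurable_cong) auto
qed

text \<open>Passing from \<open>F T\<close> to \<open>M\<close> gives joint measurability over
  \<open>M\<close>, as Tonelli's theorem with the expectation requires.\<close>

lemma (in usual_filtered_prob_space) progressively_measurable_terminal_clamp: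
  assumes "progressively_measurable F T u"
  shows "(\<lambda>(s, \<omega>). u (max 0 (min s T)) \<omega>) \<in> borel_measurable (borel \<Otimes>\<^sub>M M)"
proof -
  have T: "T \<in> {0..T}" using horizon_pos by simp
  have id: "(\<lambda>\<omega>. \<omega>) \<in> M \<rightarrow>\<^sub>M F T"
    by (rule measurable_from_subalg[OF subalg[OF T]]) simp
  have "(\<lambda>p. (fst p, snd p)) \<in> borel \<Otimes>\<^sub>M M \<rightarrow>\<^sub>M borel \<Otimes>\<^sub>M F T"
    by (rule measurable_Pair[OF measurable_fst measurable_compose[OF measurable_snd id]])
  from measurable_compose[OF this progressively_measurable_clamp[OF assms T]]
  show ?thesis by (simp add: split_beta')
qed

section \<open>The cost and admissibility of the moving-average control\<close>

theorem theorem2p1: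
  fixes M :: "'a measure" and F :: "real \<Rightarrow> 'a measure" and T x \<kappa> :: real
    and \<xi> :: "real \<Rightarrow> 'a \<Rightarrow> real"
  assumes "usual_filtered_prob_space M F T"
    and "progressively_measurable F T \<xi>"
    and "\<xi> 0 \<in> borel_measurable M" and "integrable M (\<lambda>\<omega>. (\<xi> 0 \<omega>)\<^sup>2)"
    and "expected_energy M T \<xi> < \<infinity>"
    and "\<kappa> > 0"
  shows "tracking_value M F T x \<xi> \<kappa>
    \<le> ennreal (sqrt \<kappa>) * (\<integral>\<^sup>+\<omega>. ennreal ((x - \<xi> 0 \<omega>)\<^sup>2) \<partial>M)
      + ennreal (2 / sqrt \<kappa>) *
        (\<integral>\<^sup>+h\<in>{0<..}. (ennreal (exp (- h / sqrt \<kappa>)) * translation_modulus M T \<xi> h) \<partial>lborel)"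
    (is "_ \<le> ?rhs")
proof -
  interpret usual_filtered_prob_space M F T by fact
  define l where "l = sqrt \<kappa>"
  have l: "0 < l" and l2: "l\<^sup>2 = \<kappa>"
    using \<open>\<kappa> > 0\<close> by (simp_all add: l_def)
  interpret lM: pair_sigma_finite lborel M ..
  \<comment> \<open>Freezing the target outside \<open>{0..T}\<close> makes its paths Borel on the whole line.\<close>
  define Z where "Z s \<omega> = \<xi> (max 0 (min s T)) \<omega>" for s \<omega>
  have Z_eq: "Z s \<omega> = \<xi> s \<omega>" if "0 \<le> s" "s \<le> T" for s \<omega>
    using that by (simp add: Z_def)
  have [measurable]: "case_prod Z \<in> borel_measurable (borel \<Otimes>\<^sub>M M)"
    using progressively_measurable_terminal_clamp[OF assms(2)]
    by (simp add: Z_def[abs_def] split_beta')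
  have Z_path[measurable]: "(\<lambda>s. Z s \<omega>) \<in> borel_measurable borel" if "\<omega> \<in> space M" for \<omega>
    using that by measurable
  define A where "A t \<omega> = exp_average l x (\<lambda>s. Z s \<omega>) t" for t \<omega>
  have A_eq: "exp_average l x (\<lambda>s. \<xi> s \<omega>) t = A t \<omega>" if "t \<le> T" for t \<omega>
    unfolding A_def using that by (intro exp_average_cong) (simp add: Z_eq)
  define u where "u t \<omega> = (\<xi> t \<omega> - exp_average l x (\<lambda>s. \<xi> s \<omega>) t) / l" for t \<omega>
  have u_eq: "u t \<omega> = (Z t \<omega> - A t \<omega>) / l" if "0 \<le> t" "t \<le> T" for t \<omega>
    using that by (simp add: u_def A_eq Z_eq)
  have u_prog: "progressively_measurable F T u"
    using assms(2) progressively_measurable_exp_average[OF assms(2), of l x]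
    unfolding progressively_measurable_def u_def split_beta'
    by (intro ballI borel_measurable_divide borel_measurable_diff) auto
  define \<Delta> where "\<Delta> h \<omega> = (\<integral>\<^sup>+t\<in>{0..T}. ennreal (\<bar>Z t \<omega> - Z (max (t - h) 0) \<omega>\<bar>\<^sup>2) \<partial>lborel)" for h \<omega>
  have [measurable]: "case_prod \<Delta> \<in> borel_measurable (borel \<Otimes>\<^sub>M M)"
    unfolding \<Delta>_def by measurable
  \<comment> \<open>Positive \<open>h\<close> keeps \<open>max (t - h) 0\<close> inside
    \<open>{0..T}\<close>, where \<open>Z\<close> and \<open>\<xi>\<close> agree.\<close>
  have \<Delta>: "translation_modulus M T \<xi> h = (\<integral>\<^sup>+\<omega>. \<Delta> h \<omega> \<partial>M)" if "0 < h" for h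
    unfolding translation_modulus_def \<Delta>_def using that
    by (intro nn_integral_cong) (auto simp: Z_eq indicator_def)
  have "expected_energy M T \<xi> = (\<integral>\<^sup>+\<omega>. (\<integral>\<^sup>+t\<in>{0..T}. ennreal ((Z t \<omega>)\<^sup>2) \<partial>lborel) \<partial>M)"
    unfolding expected_energy_def
    by (intro nn_integral_cong) (auto simp: Z_eq indicator_def)
  \<comment> \<open>Finite expected energy gives finite energy for almost every path only; the
    pathwise cost identity below is used off the exceptional null set.\<close>
  with assms(5) have "AE \<omega> in M. (\<integral>\<^sup>+t\<in>{0..T}. ennreal ((Z t \<omega>)\<^sup>2) \<partial>lborel) \<noteq> \<infinity>"
    by (intro nn_integral_PInf_AE) auto
  then have Z_int: "AE \<omega> in M. set_integrable lborel {0..T} (\<lambda>s. Z s \<omega>)"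
    using AE_space
  proof eventually_elim
    case (elim \<omega>)
    then show ?case
      by (intro set_integrable_if_square_nn_integral_finite) (auto simp: less_top)
  qed
  \<comment> \<open>As \<kappa> u^2 = (A - Z)^2, the two cost terms are equal halves of the same
    integral.\<close>
  have path_cost:
    "ennreal (1 / 2) * (\<integral>\<^sup>+t\<in>{0..T}. ennreal ((controlled_state x u t \<omega> - \<xi> t \<omega>)\<^sup>2) \<partial>lborel)
       + ennreal (\<kappa> / 2) * (\<integral>\<^sup>+t\<in>{0..T}. ennreal ((u t \<omega>)\<^sup>2) \<partial>lborel)
     = (\<integral>\<^sup>+t\<in>{0..T}. ennreal ((A t \<omega> - Z t \<omega>)\<^sup>2) \<partial>lborel)"
    if Zi: "set_integrable lborel {0..T} (\<lambda>s. Z s \<omega>)" and \<omega>: "\<omega> \<in> space M" for \<omega>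
  proof -
    let ?c = "\<integral>\<^sup>+t\<in>{0..T}. ennreal ((A t \<omega> - Z t \<omega>)\<^sup>2) \<partial>lborel"
    have state: "controlled_state x u t \<omega> = A t \<omega>" if t: "0 \<le> t" "t \<le> T" for t
    proof -
      have "controlled_state x u t \<omega> = x + (LINT s:{0..t}|lborel. (Z s \<omega> - A s \<omega>) / l)"
        unfolding controlled_state_def using t
        by (intro arg_cong2[where f="(+)"] set_lebesgue_integral_cong) (auto simp: u_eq)
      also have "\<dots> = A t \<omega>"
        unfolding A_def
        by (rule exp_average_eq_primitive[OF l t(1), symmetric])
          (rule set_integrable_subset[OF Zi], use t in auto)
      finally show ?thesis .
    qed
    have [measurable]: "(\<lambda>t. Z t \<omega>) \<in> borel_measurable borel" using Z_path[OF \<omega>] .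
    have [measurable]: "(\<lambda>t. A t \<omega>) \<in> borel_measurable borel"
      unfolding A_def exp_average_def set_lebesgue_integral_def indicator_def of_bool_def by simp
    have "(\<integral>\<^sup>+t\<in>{0..T}. ennreal ((controlled_state x u t \<omega> - \<xi> t \<omega>)\<^sup>2) \<partial>lborel) = ?c"
      by (intro nn_integral_cong) (auto simp: state Z_eq indicator_def)
    moreover have "(\<integral>\<^sup>+t\<in>{0..T}. ennreal ((u t \<omega>)\<^sup>2) \<partial>lborel)
        = (\<integral>\<^sup>+t. ennreal (1 / \<kappa>) * (ennreal ((A t \<omega> - Z t \<omega>)\<^sup>2) * indicator {0..T} t) \<partial>lborel)"
      using \<open>\<kappa> > 0\<close> by (intro nn_integral_cong)
        (auto simp: u_eq power_divide l2 indicator_def power2_commute simp flip: ennreal_mult)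
    then have "(\<integral>\<^sup>+t\<in>{0..T}. ennreal ((u t \<omega>)\<^sup>2) \<partial>lborel) = ennreal (1 / \<kappa>) * ?c"
      by (simp add: nn_integral_cmult)
    moreover have "ennreal (\<kappa> / 2) * (ennreal (1 / \<kappa>) * ?c) = ennreal (1 / 2) * ?c"
      using \<open>\<kappa> > 0\<close> by (simp add: mult.assoc[symmetric] ennreal_mult[symmetric])
    moreover have "ennreal (1 / 2) * ?c + ennreal (1 / 2) * ?c = ?c"
    proof -
      have half: "ennreal (1 / 2) + ennreal (1 / 2) = 1"
        by (subst ennreal_plus[symmetric]) simp_all
      show ?thesis by (simp only: distrib_right[symmetric] half mult_1)
    qed
    ultimately show ?thesis by simp
  qed
  have "tracking_cost M T x \<xi> \<kappa> u \<le> (\<integral>\<^sup>+\<omega>. ennreal l * ennreal ((x - \<xi> 0 \<omega>)\<^sup>2)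
      + ennreal (2 / l) * (\<integral>\<^sup>+h\<in>{0<..}. (ennreal (exp (- h / l)) * \<Delta> h \<omega>) \<partial>lborel) \<partial>M)"
    unfolding tracking_cost_def
  proof (rule nn_integral_mono_AE)
    show "AE \<omega> in M.
      ennreal (1 / 2) * (\<integral>\<^sup>+t\<in>{0..T}. ennreal ((controlled_state x u t \<omega> - \<xi> t \<omega>)\<^sup>2) \<partial>lborel)
        + ennreal (\<kappa> / 2) * (\<integral>\<^sup>+t\<in>{0..T}. ennreal ((u t \<omega>)\<^sup>2) \<partial>lborel)
      \<le> ennreal l * ennreal ((x - \<xi> 0 \<omega>)\<^sup>2)
        + ennreal (2 / l) * (\<integral>\<^sup>+h\<in>{0<..}. (ennreal (exp (- h / l)) * \<Delta> h \<omega>) \<partial>lborel)"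
      using Z_int AE_space
    proof eventually_elim
      case (elim \<omega>)
      show ?case
        unfolding path_cost[OF elim]
        using nn_integral_exp_average_error_le[OF l elim(1) Z_path[OF elim(2)], of x] l horizon_pos
        by (simp add: A_def \<Delta>_def Z_eq ennreal_mult)
    qed
  qed
  also have "\<dots> = ennreal l * (\<integral>\<^sup>+\<omega>. ennreal ((x - \<xi> 0 \<omega>)\<^sup>2) \<partial>M)
      + ennreal (2 / l) * (\<integral>\<^sup>+\<omega>. (\<integral>\<^sup>+h\<in>{0<..}. (ennreal (exp (- h / l)) * \<Delta> h \<omega>) \<partial>lborel) \<partial>M)"
    using assms(3) by (simp add: nn_integral_add nn_integral_cmult)
  \<comment> \<open>Tonelli brings the expectation inside the \<open>h\<close> integral, where it
    turns \<open>\<Delta>\<close> into the modulus.\<close>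
  also have "(\<integral>\<^sup>+\<omega>. (\<integral>\<^sup>+h\<in>{0<..}. (ennreal (exp (- h / l)) * \<Delta> h \<omega>) \<partial>lborel) \<partial>M)
      = (\<integral>\<^sup>+h. (\<integral>\<^sup>+\<omega>. ennreal (exp (- h / l)) * \<Delta> h \<omega> * indicator {0<..} h \<partial>M) \<partial>lborel)"
    by (rule lM.Fubini') simp
  also have "\<dots> = (\<integral>\<^sup>+h\<in>{0<..}. (ennreal (exp (- h / l)) * translation_modulus M T \<xi> h) \<partial>lborel)"
    by (intro nn_integral_cong) (auto simp: \<Delta> nn_integral_cmult indicator_def)
  finally have cost: "tracking_cost M T x \<xi> \<kappa> u \<le> ?rhs"
    by (simp add: l_def)
  show ?thesis
  \<comment> \<open>Admissibility of \<open>u\<close> is read off from the cost bound: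
    \<open>\<kappa> / 2\<close> times the energy is part of the cost, hence finite when the
    right-hand side is. An infinite right-hand side makes the claim trivial.\<close>
  proof (cases "?rhs = \<infinity>")
    case True
    show ?thesis unfolding True by simp
  next
    case False
    have [measurable]: "(\<lambda>\<omega>. \<integral>\<^sup>+t\<in>{0..T}. ennreal ((u t \<omega>)\<^sup>2) \<partial>lborel) \<in> borel_measurable M"
    proof -
      note [measurable] = progressively_measurable_terminal_clamp[OF u_prog]
      have "(\<lambda>\<omega>. \<integral>\<^sup>+t\<in>{0..T}. ennreal ((u (max 0 (min t T)) \<omega>)\<^sup>2) \<partial>lborel) \<in> borel_measurable M"
        by measurable
      moreover have "(\<integral>\<^sup>+t\<in>{0..T}. ennreal ((u (max 0 (min t T)) \<omega>)\<^sup>2) \<partial>lborel)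
          = (\<integral>\<^sup>+t\<in>{0..T}. ennreal ((u t \<omega>)\<^sup>2) \<partial>lborel)" for \<omega>
        by (intro nn_integral_cong) (auto simp: indicator_def)
      ultimately show ?thesis by simp
    qed
    have "ennreal (\<kappa> / 2) * expected_energy M T u
        = (\<integral>\<^sup>+\<omega>. ennreal (\<kappa> / 2) * (\<integral>\<^sup>+t\<in>{0..T}. ennreal ((u t \<omega>)\<^sup>2) \<partial>lborel) \<partial>M)"
      unfolding expected_energy_def by (simp add: nn_integral_cmult)
    also have "\<dots> \<le> tracking_cost M T x \<xi> \<kappa> u"
      unfolding tracking_cost_def by (intro nn_integral_mono) auto
    also have "\<dots> < \<infinity>"
      using False by (intro order_le_less_trans[OF cost]) (simp only: infinity_ennreal_def less_top)
    finally have "expected_energy M T u < \<infinity>"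
      using \<open>\<kappa> > 0\<close> by (auto simp: ennreal_mult_less_top)
    with u_prog have "u \<in> admissible_controls M F T"
      by (simp add: admissible_controls_def)
    then have "tracking_value M F T x \<xi> \<kappa> \<le> tracking_cost M T x \<xi> \<kappa> u"
      unfolding tracking_value_def by (rule INF_lower)
    also note cost
    finally show ?thesis .
  qed
qed

end
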